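(* For all $s \in \mathbb{C}$, \begin{equation*} \mathcal{C}_k(z,k-s) = e^{s i \pi} N^{k/2-s}\, \mathcal{C}_k( z, s)|_k \omega . \end{equation*}
   Context: Let $N\geqslant 1$ be an integer and $\Gamma=\Gamma_0(N)$ the Hecke congruence group of level $N$; let $k\geqslant 6$ be an even integer and $z\in\mathbb{H}$. For $\gamma=\left(\begin{smallmatrix} a & b\\ c& d\end{smallmatrix}\right)$ put $j(\gamma,z)=cz+d$, and for $s\in\mathbb{C}$ define $z^s=e^{s\log z}$ with the principal branch of the logarithm. Cohen's kernel is $$\mathcal{C}_k(z,s)=\sum_{\gamma\in\Gamma}\frac{1}{(\gamma z)^s\, j(\gamma,z)^k},$$ absolutely convergent for $1<\mathrm{Re}(s)<k-1$, and extended to all $s\in\mathbb{C}$ by analytic continuation (it is a weight $k$ cusp form for $\Gamma_0(N)$ in $z$). Let $\omega=\left(\begin{smallmatrix} 0 & -1 \\ N & 0\end{smallmatrix}\right)$ and for a function $f$ on $\mathbb{H}$ let $(f|_k\omega)(z)=(\det\omega)^{k/2} j(\omega,z)^{-k} f(\omega z)=N^{k/2}(Nz)^{-k}f(-1/(Nz))$; here $\mathcal{C}_k(z,s)|_k\omega$ denotes this operator applied in the variable $z$. *)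

theory Defs
  imports "HOL-Complex_Analysis.Complex_Analysis"
begin

definition Gamma0 :: "nat \<Rightarrow> (int^2^2) set" where
  "Gamma0 N = {\<gamma>. det \<gamma> = 1 \<and> int N dvd \<gamma>$2$1}"

definition jfactor :: "int^2^2 \<Rightarrow> complex \<Rightarrow> complex" where
  "jfactor \<gamma> z = of_int (\<gamma>$2$1) * z + of_int (\<gamma>$2$2)"

definition moebius :: "int^2^2 \<Rightarrow> complex \<Rightarrow> complex" where
  "moebius \<gamma> z = (of_int (\<gamma>$1$1) * z + of_int (\<gamma>$1$2)) / (of_int (\<gamma>$2$1) * z + of_int (\<gamma>$2$2))"

definition slash :: "nat \<Rightarrow> int^2^2 \<Rightarrow> (complex \<Rightarrow> complex) \<Rightarrow> complex \<Rightarrow> complex" where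
  "slash k \<gamma> f z =
     of_real (real_of_int (det \<gamma>) powr (real k / 2)) / jfactor \<gamma> z ^ k * f (moebius \<gamma> z)"

definition omega :: "nat \<Rightarrow> int^2^2" where
  "omega N = vector [vector [0, -1], vector [int N, 0]]"

text \<open>
  The complex power is the principal one, and the unordered infinite sum of complex terms
  is absolute summation.
\<close>

definition cohen_series :: "nat \<Rightarrow> nat \<Rightarrow> complex \<Rightarrow> complex \<Rightarrow> complex" where
  "cohen_series N k z s =
     (\<Sum>\<^sub>\<infinity>\<gamma>\<in>Gamma0 N. 1 / (moebius \<gamma> z powr s * jfactor \<gamma> z ^ k))"

text \<open>
  The entire function extending \<open>f\<close> from \<open>S\<close>; it is unique if \<open>S\<close> has a limit point.
  As usual for partial operations, the value is \<open>0\<close> if there is no extension.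
\<close>

definition entire_continuation ::
    "complex set \<Rightarrow> (complex \<Rightarrow> complex) \<Rightarrow> complex \<Rightarrow> complex" where
  "entire_continuation S f =
     (if \<exists>F. F holomorphic_on UNIV \<and> (\<forall>s\<in>S. F s = f s)
      then THE F. F holomorphic_on UNIV \<and> (\<forall>s\<in>S. F s = f s)
      else (\<lambda>_. 0))"

text \<open>The strip below is the one on which the series converges absolutely.\<close>

definition cohen_kernel :: "nat \<Rightarrow> nat \<Rightarrow> complex \<Rightarrow> complex \<Rightarrow> complex" where
  "cohen_kernel N k z =
     entire_continuation {s. 1 < Re s \<and> Re s < real k - 1} (cohen_series N k z)"

end

theory Submission
  imports Defs
begin

text \<open>
  Cohen's series is the sum of \<open>p\<^sub>s |\<^sub>k \<gamma>\<close> over \<open>\<gamma> \<in> \<Gamma>\<^sub>0(N)\<close>, where \<open>p\<^sub>s(w) = w\<^bsup>-s\<^esup>\<close>. The Fricke matrix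
  \<open>\<omega>\<close> normalises \<open>\<Gamma>\<^sub>0(N)\<close>, so slashing the series with \<open>\<omega>\<close> replaces \<open>p\<^sub>s\<close> by \<open>p\<^sub>s |\<^sub>k \<omega>\<close>. Because
  \<open>log (-1/w) = i \<pi> - log w\<close> in the upper half plane, the latter is \<open>p\<^sub>k\<^sub>-\<^sub>s\<close> up to an entire
  nonvanishing factor in \<open>s\<close>. The strip of convergence is symmetric under \<open>s \<mapsto> k - s\<close>, so the
  identity of the series passes to the entire continuations, and one of these exists iff the
  other does.
\<close>

subsection \<open>Entire continuation\<close>

definition entire_extension :: "complex set \<Rightarrow> (complex \<Rightarrow> complex) \<Rightarrow> (complex \<Rightarrow> complex) \<Rightarrow> bool"
  where "entire_extension S f F \<longleftrightarrow> F holomorphic_on UNIV \<and> (\<forall>s\<in>S. F s = f s)"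

lemma entire_extension_unique:
  assumes "\<xi> islimpt S" "entire_extension S f F" "entire_extension S f G"
  shows "F = G"
proof
  fix s
  have "F s - G s = 0"
    by (rule analytic_continuation[of "\<lambda>s. F s - G s" UNIV S \<xi>])
       (use assms in \<open>auto simp: entire_extension_def intro: holomorphic_on_diff\<close>)
  then show "F s = G s" by simp
qed

lemma entire_continuation_eqI:
  assumes "\<xi> islimpt S" "entire_extension S f F"
  shows "entire_continuation S f = F"
proof -
  have "(THE F. entire_extension S f F) = F"
    using assms by (blast intro: the_equality entire_extension_unique)
  with assms(2) show ?thesis
    by (auto simp: entire_continuation_def simp flip: entire_extension_def)
qed

lemma entire_continuation_eq_0:
  assumes "\<nexists>F. entire_extension S f F"
  shows "entire_continuation S f = (\<lambda>_. 0)"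
  using assms by (simp add: entire_continuation_def flip: entire_extension_def)

lemma entire_continuation_transfer:
  assumes limpt: "\<xi> islimpt S" "\<eta> islimpt S'"
    and ext: "\<And>F. entire_extension S f F \<Longrightarrow> entire_extension S' g (T F)"
    and ext_conv: "\<And>G. entire_extension S' g G \<Longrightarrow> \<exists>F. entire_extension S f F"
    and zero: "T (\<lambda>_. 0) = (\<lambda>_. 0)"
  shows "entire_continuation S' g = T (entire_continuation S f)"
proof (cases "\<exists>F. entire_extension S f F")
  case True
  then obtain F where F: "entire_extension S f F" by blast
  show ?thesis
    using entire_continuation_eqI[OF limpt(1) F] entire_continuation_eqI[OF limpt(2) ext[OF F]]
    by simp
next
  case False
  moreover from this have "\<nexists>G. entire_extension S' g G" using ext_conv by blast
  ultimately show ?thesis by (simp add: entire_continuation_eq_0 zero)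
qed

lemma entire_continuation_mult:
  assumes limpt: "\<xi> islimpt S" and h: "h holomorphic_on UNIV" "\<And>s. h s \<noteq> 0"
  shows "entire_continuation S (\<lambda>s. h s * f s) = (\<lambda>s. h s * entire_continuation S f s)"
proof (rule entire_continuation_transfer[OF limpt limpt])
  show "entire_extension S (\<lambda>s. h s * f s) (\<lambda>s. h s * F s)" if "entire_extension S f F" for F
    using that h by (auto simp: entire_extension_def intro: holomorphic_on_mult)
  show "\<exists>F. entire_extension S f F" if "entire_extension S (\<lambda>s. h s * f s) G" for G
  proof
    show "entire_extension S f (\<lambda>s. G s / h s)"
      using that h by (auto simp: entire_extension_def intro: holomorphic_on_divide)
  qed
qed simp

lemma entire_continuation_compose:
  assumes limpt: "\<xi> islimpt S"
    and hol: "\<phi> holomorphic_on UNIV" "\<psi> holomorphic_on UNIV"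
    and inv: "\<And>s. \<psi> (\<phi> s) = s" "\<And>s. \<phi> (\<psi> s) = s"
  shows "entire_continuation (\<phi> -` S) (f \<circ> \<phi>) = entire_continuation S f \<circ> \<phi>"
proof (rule entire_continuation_transfer[OF limpt])
  have hol_comp: "(F \<circ> \<theta>) holomorphic_on UNIV"
    if "F holomorphic_on UNIV" "\<theta> holomorphic_on UNIV" for F \<theta> :: "complex \<Rightarrow> complex"
    using that by (auto intro: holomorphic_on_compose holomorphic_on_subset)
  have "isCont \<psi> \<xi>"
    using holomorphic_on_imp_continuous_on[OF hol(2)]
    by (simp add: continuous_on_eq_continuous_at)
  moreover have "\<psi> s \<noteq> \<psi> \<xi>" if "s \<noteq> \<xi>" for s using inv(2) that by metis
  ultimately have "\<psi> \<xi> islimpt \<psi> ` S"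
    using limpt by (intro islimpt_isCont_image) (auto simp: eventually_at_topological)
  also have "\<psi> ` S = \<phi> -` S" by (auto simp: image_iff inv) (metis inv(1))
  finally show "\<psi> \<xi> islimpt \<phi> -` S" .
  show "entire_extension (\<phi> -` S) (f \<circ> \<phi>) (F \<circ> \<phi>)" if "entire_extension S f F" for F
    using that hol(1) hol_comp by (auto simp: entire_extension_def)
  show "\<exists>F. entire_extension S f F" if "entire_extension (\<phi> -` S) (f \<circ> \<phi>) G" for G
  proof
    show "entire_extension S f (G \<circ> \<psi>)"
      using that hol(2) hol_comp inv by (auto simp: entire_extension_def)
  qed
qed auto

lemma entire_continuation_diff:
  assumes limpt: "\<xi> islimpt S" and S: "\<And>s. c - s \<in> S \<longleftrightarrow> s \<in> S"
  shows "entire_continuation S f (c - s) = entire_continuation S (\<lambda>s. f (c - s)) s"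
proof -
  have "entire_continuation ((\<lambda>s. c - s) -` S) (f \<circ> (\<lambda>s. c - s))
      = entire_continuation S f \<circ> (\<lambda>s. c - s)"
    by (rule entire_continuation_compose[OF limpt, where \<psi> = "\<lambda>s. c - s"])
       (auto intro!: holomorphic_intros)
  moreover have "(\<lambda>s. c - s) -` S = S" using S by auto
  ultimately show ?thesis by (simp add: o_def fun_eq_iff)
qed

subsection \<open>The slash operator\<close>

lemma Im_moebius: "Im (moebius \<gamma> z) = of_int (det \<gamma>) * Im z / (norm (jfactor \<gamma> z))\<^sup>2"
  by (simp add: moebius_def jfactor_def Im_divide' det_2 algebra_simps)

lemma jfactor_nonzero:
  assumes "det \<gamma> \<noteq> 0" "Im z \<noteq> 0"
  shows "jfactor \<gamma> z \<noteq> 0"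
proof
  assume "jfactor \<gamma> z = 0"
  then have "Im (jfactor \<gamma> z) = 0" "Re (jfactor \<gamma> z) = 0" by simp_all
  then have "\<gamma>$2$1 = 0" "\<gamma>$2$2 = 0" using assms(2) by (auto simp: jfactor_def)
  with assms(1) show False by (simp add: det_2)
qed

lemma Im_moebius_pos:
  assumes "det \<gamma> > 0" "Im z > 0"
  shows "Im (moebius \<gamma> z) > 0"
  using assms jfactor_nonzero[of \<gamma> z] by (simp add: Im_moebius)

lemma jfactor_mult:
  assumes "jfactor B z \<noteq> 0"
  shows "jfactor (A ** B) z = jfactor A (moebius B z) * jfactor B z"
  using assms
  by (simp add: jfactor_def moebius_def matrix_matrix_mult_def sum_2 field_simps)

lemma moebius_mult:
  assumes "jfactor B z \<noteq> 0"
  shows "moebius (A ** B) z = moebius A (moebius B z)"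
proof -
  define num where
    "num \<gamma> w = of_int (\<gamma>$1$1) * w + of_int (\<gamma>$1$2)" for \<gamma> :: "int^2^2" and w :: complex
  have moebius_eq: "moebius \<gamma> w = num \<gamma> w / jfactor \<gamma> w" for \<gamma> w
    by (simp add: moebius_def num_def jfactor_def)
  have "num (A ** B) z = num A (moebius B z) * jfactor B z"
    using assms
    by (simp add: num_def jfactor_def moebius_def matrix_matrix_mult_def sum_2 field_simps)
  with assms show ?thesis by (simp add: moebius_eq[of "A ** B"] moebius_eq[of A] jfactor_mult)
qed

lemma slash_mult:
  assumes "jfactor B z \<noteq> 0"
  shows "slash k (A ** B) f z = slash k B (slash k A f) z"
  using assms
  by (simp add: slash_def det_mul jfactor_mult moebius_mult powr_mult power_mult_distrib mult_ac)

lemma slash_cong: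
  assumes "f (moebius \<gamma> z) = g (moebius \<gamma> z)"
  shows "slash k \<gamma> f z = slash k \<gamma> g z"
  using assms by (simp add: slash_def)

lemma slash_cmult: "slash k \<gamma> (\<lambda>w. c * f w) z = c * slash k \<gamma> f z"
  by (simp add: slash_def)

lemma slash_infsum: "slash k \<gamma> (\<lambda>w. \<Sum>\<^sub>\<infinity>i\<in>I. f i w) z = (\<Sum>\<^sub>\<infinity>i\<in>I. slash k \<gamma> (f i) z)"
  unfolding slash_def by (rule infsum_cmult_right'[symmetric])

lemma entire_continuation_slash:
  assumes "\<xi> islimpt S" "det \<gamma> \<noteq> 0" "Im z \<noteq> 0"
  shows "entire_continuation S (\<lambda>s. slash k \<gamma> (\<lambda>w. f w s) z)
    = (\<lambda>s. slash k \<gamma> (\<lambda>w. entire_continuation S (f w) s) z)"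
  unfolding slash_def
  by (rule entire_continuation_mult[OF assms(1)]) (use assms jfactor_nonzero in auto)

subsection \<open>The Fricke involution\<close>

lemma det_omega: "det (omega N) = int N"
  and jfactor_omega: "jfactor (omega N) z = of_nat N * z"
  and moebius_omega: "moebius (omega N) z = - inverse (of_nat N * z)"
  by (simp_all add: omega_def det_2 jfactor_def moebius_def divide_inverse)

definition fricke_conj :: "nat \<Rightarrow> int^2^2 \<Rightarrow> int^2^2" where
  "fricke_conj N \<gamma> =
     vector [vector [\<gamma>$2$2, - (\<gamma>$2$1 div int N)], vector [- (int N * \<gamma>$1$2), \<gamma>$1$1]]"

lemma fricke_conj_mult_omega:
  assumes "\<gamma> \<in> Gamma0 N"
  shows "fricke_conj N \<gamma> ** omega N = omega N ** \<gamma>"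
  using assms
  by (auto simp: fricke_conj_def omega_def Gamma0_def vec_eq_iff forall_2
      matrix_matrix_mult_def sum_2)

lemma fricke_conj_in_Gamma0:
  assumes "\<gamma> \<in> Gamma0 N"
  shows "fricke_conj N \<gamma> \<in> Gamma0 N"
  using assms by (auto simp: fricke_conj_def Gamma0_def det_2 algebra_simps)

lemma fricke_conj_involution:
  assumes "N > 0" "\<gamma> \<in> Gamma0 N"
  shows "fricke_conj N (fricke_conj N \<gamma>) = \<gamma>"
proof -
  have "- (int N * \<gamma>$1$2) div int N = - \<gamma>$1$2"
    using assms(1) nonzero_mult_div_cancel_left[of "int N" "- \<gamma>$1$2"] by simp
  with assms show ?thesis by (auto simp: fricke_conj_def vec_eq_iff forall_2 Gamma0_def)
qed

lemma bij_betw_fricke_conj: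
  assumes "N > 0"
  shows "bij_betw (fricke_conj N) (Gamma0 N) (Gamma0 N)"
  by (rule bij_betw_byWitness[where f' = "fricke_conj N"])
     (use assms in \<open>auto simp: fricke_conj_involution fricke_conj_in_Gamma0\<close>)

lemma minus_inverse_powr:
  assumes "Im w > 0"
  shows "(- inverse w) powr s = exp (s * \<i> * of_real pi) * w powr (- s)"
proof -
  have "w \<noteq> 0" using assms by auto
  moreover have "w \<notin> \<real>\<^sub>\<le>\<^sub>0" using assms by (auto simp: complex_nonpos_Reals_iff)
  moreover have "Im (inverse w) < 0"
    using assms by (simp add: Im_complex_div_lt_0 inverse_eq_divide)
  ultimately have "Ln (- inverse w) = \<i> * of_real pi - Ln w"
    using assms by (simp add: Ln_minus Ln_inverse)
  with \<open>w \<noteq> 0\<close> have "(- inverse w) powr s = exp (s * (\<i> * of_real pi - Ln w))"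
    by (simp add: powr_def)
  also have "\<dots> = exp (s * \<i> * of_real pi) * w powr (- s)"
    using \<open>w \<noteq> 0\<close> by (simp add: powr_def algebra_simps flip: exp_add)
  finally show ?thesis .
qed

lemma slash_omega_powr:
  assumes N: "N > 0" and z: "Im z > 0"
  shows "exp (s * \<i> * of_real pi) * of_nat N powr (of_nat k / 2 - s) *
      slash k (omega N) (\<lambda>w. w powr (- s)) z = z powr (s - of_nat k)"
    (is "?E * ?P * _ = _")
proof -
  define w where "w = of_nat N * z"
  have w: "w \<noteq> 0" "Im w > 0" using N z by (auto simp: w_def)
  have "slash k (omega N) (\<lambda>w. w powr (- s)) z
      = of_nat N powr (of_nat k / 2) * (w powr s / w powr of_nat k) / ?E"
  proof -
    have "of_real (real N powr (real k / 2)) = (of_nat N powr (of_nat k / 2) :: complex)"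
      using powr_of_real[of "real N" "real k / 2"] by simp
    moreover have "(- inverse w) powr (- s) = w powr s / ?E"
      using minus_inverse_powr[OF w(2), of "- s"] by (simp add: exp_minus divide_inverse)
    moreover have "w powr of_nat k = w ^ k" using w(1) by (simp add: powr_nat)
    ultimately show ?thesis
      unfolding slash_def det_omega jfactor_omega moebius_omega w_def[symmetric] by simp
  qed
  also have "w powr s / w powr of_nat k = of_nat N powr (s - of_nat k) * z powr (s - of_nat k)"
    unfolding powr_diff[symmetric] w_def by (simp add: powr_times_real_left)
  finally have "?E * ?P * slash k (omega N) (\<lambda>w. w powr (- s)) z
      = ?P * of_nat N powr (of_nat k / 2) * of_nat N powr (s - of_nat k) * z powr (s - of_nat k)"
    by simp
  also have "?P * of_nat N powr (of_nat k / 2) * of_nat N powr (s - of_nat k) = 1"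
    using N by (simp flip: powr_add)
  finally show ?thesis by simp
qed

subsection \<open>The functional equation\<close>

lemma cohen_series_eq_infsum_slash:
  "cohen_series N k z s = (\<Sum>\<^sub>\<infinity>\<gamma>\<in>Gamma0 N. slash k \<gamma> (\<lambda>w. w powr (- s)) z)"
  unfolding cohen_series_def
  by (intro infsum_cong) (simp add: slash_def Gamma0_def powr_minus field_simps)

lemma slash_omega_cohen_series:
  assumes N: "N > 0" and z: "Im z > 0"
  shows "slash k (omega N) (\<lambda>w. cohen_series N k w s) z =
      (\<Sum>\<^sub>\<infinity>\<gamma>\<in>Gamma0 N. slash k \<gamma> (slash k (omega N) (\<lambda>w. w powr (- s))) z)"
proof -
  let ?p = "\<lambda>w. w powr (- s)"
  have "slash k (omega N) (\<lambda>w. cohen_series N k w s) z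
      = (\<Sum>\<^sub>\<infinity>\<gamma>\<in>Gamma0 N. slash k (omega N) (slash k \<gamma> ?p) z)"
    unfolding cohen_series_eq_infsum_slash by (rule slash_infsum)
  also have "\<dots> = (\<Sum>\<^sub>\<infinity>\<gamma>\<in>Gamma0 N. slash k (omega N) (slash k (fricke_conj N \<gamma>) ?p) z)"
    by (rule infsum_reindex_bij_betw[OF bij_betw_fricke_conj[OF N], symmetric])
  also have "\<dots> = (\<Sum>\<^sub>\<infinity>\<gamma>\<in>Gamma0 N. slash k \<gamma> (slash k (omega N) ?p) z)"
  proof (rule infsum_cong)
    fix \<gamma> assume \<gamma>: "\<gamma> \<in> Gamma0 N"
    have "jfactor (omega N) z \<noteq> 0" "jfactor \<gamma> z \<noteq> 0"
      using \<gamma> N z jfactor_nonzero[of _ z] by (simp_all add: Gamma0_def det_omega)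
    then show "slash k (omega N) (slash k (fricke_conj N \<gamma>) ?p) z
        = slash k \<gamma> (slash k (omega N) ?p) z"
      by (simp add: fricke_conj_mult_omega[OF \<gamma>] flip: slash_mult)
  qed
  finally show ?thesis .
qed

lemma cohen_series_reflect:
  assumes N: "N > 0" and z: "Im z > 0"
  shows "cohen_series N k z (of_nat k - s) =
      exp (s * \<i> * of_real pi) * of_nat N powr (of_nat k / 2 - s) *
      slash k (omega N) (\<lambda>w. cohen_series N k w s) z"
proof -
  let ?c = "exp (s * \<i> * of_real pi) * of_nat N powr (of_nat k / 2 - s)"
  have "slash k \<gamma> (\<lambda>w. w powr (s - of_nat k)) z
      = ?c * slash k \<gamma> (slash k (omega N) (\<lambda>w. w powr (- s))) z" if "\<gamma> \<in> Gamma0 N" for \<gamma>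
  proof -
    have "Im (moebius \<gamma> z) > 0" using that z by (intro Im_moebius_pos) (auto simp: Gamma0_def)
    then have "slash k \<gamma> (\<lambda>w. w powr (s - of_nat k)) z
        = slash k \<gamma> (\<lambda>w. ?c * slash k (omega N) (\<lambda>w. w powr (- s)) w) z"
      by (intro slash_cong slash_omega_powr[OF N, symmetric])
    then show ?thesis by (simp only: slash_cmult)
  qed
  then have "cohen_series N k z (of_nat k - s)
      = (\<Sum>\<^sub>\<infinity>\<gamma>\<in>Gamma0 N. ?c * slash k \<gamma> (slash k (omega N) (\<lambda>w. w powr (- s))) z)"
    unfolding cohen_series_eq_infsum_slash by (intro infsum_cong) simp
  then show ?thesis
    by (simp add: infsum_cmult_right' slash_omega_cohen_series[OF N z])
qed

theorem theorem5p6: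
  fixes N k :: nat and z :: complex
  assumes "N \<ge> 1" and "k \<ge> 6" and "even k" and "Im z > 0"
  shows "\<forall>s :: complex.
    cohen_kernel N k z (of_nat k - s) =
      exp (s * \<i> * of_real pi) * of_nat N powr (of_nat k / 2 - s) *
      slash k (omega N) (\<lambda>w. cohen_kernel N k w s) z"
proof
  fix s :: complex
  let ?S = "{s. 1 < Re s \<and> Re s < real k - 1}"
  define h where "h = (\<lambda>s. exp (s * \<i> * of_real pi) * of_nat N powr (of_nat k / 2 - s))"
  have N: "N > 0" using assms(1) by simp
  have "open ?S" by (intro open_Collect_conj open_Collect_less continuous_intros)
  then have limpt: "2 islimpt ?S"
    using assms(2) by (intro interior_limit_point) (simp add: interior_open)
  have h: "h holomorphic_on UNIV" "\<And>s. h s \<noteq> 0"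
    using N by (auto simp: h_def intro!: holomorphic_intros)
  have "cohen_kernel N k z (of_nat k - s)
      = entire_continuation ?S (\<lambda>s. cohen_series N k z (of_nat k - s)) s"
    unfolding cohen_kernel_def by (rule entire_continuation_diff[OF limpt]) auto
  also have "\<dots> = entire_continuation ?S
      (\<lambda>s. h s * slash k (omega N) (\<lambda>w. cohen_series N k w s) z) s"
    by (simp add: cohen_series_reflect[OF N assms(4)] h_def)
  also have "\<dots> = h s * slash k (omega N) (\<lambda>w. cohen_kernel N k w s) z"
    using N assms(4) by (simp add: entire_continuation_mult[OF limpt h]
        entire_continuation_slash[OF limpt] det_omega cohen_kernel_def)
  finally show "cohen_kernel N k z (of_nat k - s) =
      exp (s * \<i> * of_real pi) * of_nat N powr (of_nat k / 2 - s) *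
      slash k (omega N) (\<lambda>w. cohen_kernel N k w s) z"
    unfolding h_def .
qed

end
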